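(* For all $\hat f,\hat g\in\widehat{\mathcal O}_\theta$, $$|\hat f-\hat g|_\theta\le\theta^2\max\{|\hat f|_\theta,|\hat g|_\theta\},$$ where for $\hat h\in\widehat{\mathcal O}_\theta$, $|\hat h|_\theta:=\max_{(h_i)\in\hat h}\limsup_i|h_i|_\theta$, the maximum being over all Cauchy sequences $(h_i)$ representing $\hat h$.
   Context: $\theta>1$ is a real quadratic unit with $N(\theta)=-1$, so $\theta^2=a\theta+1$ with an integer $a\ge1$; $K=\mathbb Q(\theta)\subset\mathbb R$, $\mathcal O_K$ its ring of integers. A greedy polynomial is a finite sum $\sum_{i=m}^M b_i\theta^i$ with $b_i\in\{0,\dots,a\}$ such that $b_i=a$ implies $b_{i-1}=0$; every nonzero $\alpha\in\mathcal O_K$ is uniquely $\alpha=\pm\sum_{i=m}^Mb_i\theta^i$ greedy with $b_m\ne0$, and $|\alpha|_\theta:=\theta^{-m}$, $|0|_\theta=0$. Let $\mathcal R_\theta$ be the ring (componentwise operations) of sequences $(f_n)$ in $\mathcal O_K$ that are Cauchy for $|\cdot|_\theta$ (for each $\varepsilon>0$ there is $N$ with $|f_i-f_j|_\theta<\varepsilon$ for $i,j\ge N$), $\mathcal M_\theta$ the ideal of those with $|f_n|_\theta\to0$, and $\widehat{\mathcal O}_\theta=\mathcal R_\theta/\mathcal M_\theta$. *)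

theory Defs
  imports
    "HOL-Library.Extended_Real"
    "HOL-Library.Liminf_Limsup"
    "HOL-Computational_Algebra.Polynomial"
    "HOL-Algebra.QuotRing"
begin

text \<open>
  A quadratic unit with trace \<open>t\<close> and norm \<open>n\<close>: the number is irrational, so \<open>X\<^sup>2 - t X + n\<close> is its
  minimal polynomial and \<open>t\<close>, \<open>n\<close> are determined by it.
\<close>

definition quadratic_unit :: "real \<Rightarrow> int \<Rightarrow> int \<Rightarrow> bool" where
  "quadratic_unit \<theta> t n \<longleftrightarrow>
     \<theta> \<notin> \<rat> \<and> \<theta>\<^sup>2 - of_int t * \<theta> + of_int n = 0 \<and> \<bar>n\<bar> = 1"

lemma quadratic_unit_norm_minus_one_iff:
  assumes "\<theta> > 1"
  shows "quadratic_unit \<theta> a (-1) \<longleftrightarrow> a \<ge> 1 \<and> \<theta>\<^sup>2 = of_int a * \<theta> + 1"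
proof
  assume "quadratic_unit \<theta> a (-1)"
  then have eq: "\<theta>\<^sup>2 = of_int a * \<theta> + 1"
    by (simp add: quadratic_unit_def)
  have "\<theta>\<^sup>2 > 1"
    using assms by (simp add: one_less_power)
  with eq have "of_int a * \<theta> > 0"
    by simp
  with assms have "real_of_int a > 0"
    by (simp add: zero_less_mult_iff)
  with eq show "a \<ge> 1 \<and> \<theta>\<^sup>2 = of_int a * \<theta> + 1"
    by simp
next
  assume *: "a \<ge> 1 \<and> \<theta>\<^sup>2 = of_int a * \<theta> + 1"
  have "\<theta> \<notin> \<rat>"
  proof
    assume "\<theta> \<in> \<rat>"
    moreover have "algebraic_int \<theta>"
    proof
      show "lead_coeff [:-1, - real_of_int a, 1:] = 1"
        by simp
      show "\<forall>i. coeff [:-1, - real_of_int a, 1:] i \<in> \<int>"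
        by (auto simp: coeff_pCons split: nat.splits)
      show "poly [:-1, - real_of_int a, 1:] \<theta> = 0"
        using * by (simp add: power2_eq_square algebra_simps)
    qed
    ultimately have "\<theta> \<in> \<int>"
      by (rule rational_algebraic_int_is_int[rotated])
    then obtain k where k: "\<theta> = of_int k"
      by (auto elim: Ints_cases)
    have "real_of_int (k * (k - a)) = 1"
      using * k by (simp add: power2_eq_square algebra_simps)
    then have "k * (k - a) = 1"
      using of_int_eq_1_iff by blast
    then show False
      using assms k by (auto simp: zmult_eq_1_iff)
  qed
  with * show "quadratic_unit \<theta> a (-1)"
    by (simp add: quadratic_unit_def)
qed

definition generated_subfield :: "real \<Rightarrow> real set" where
  "generated_subfield \<theta> =
     \<Inter>{F. \<theta> \<in> F \<and> 1 \<in> F \<and> (\<forall>x\<in>F. \<forall>y\<in>F. x - y \<in> F \<and> x * y \<in> F) \<and> (\<forall>x\<in>F. inverse x \<in> F)}"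

definition ring_of_integers :: "real \<Rightarrow> real set" where
  "ring_of_integers \<theta> = {x \<in> generated_subfield \<theta>. algebraic_int x}"

text \<open>
  The digits of a greedy polynomial are extended by zero to all of \<open>\<int>\<close>, so that the digit below
  the lowest position is \<open>0\<close>.
\<close>

definition greedy_digits :: "int \<Rightarrow> int \<Rightarrow> int \<Rightarrow> (int \<Rightarrow> int) \<Rightarrow> bool" where
  "greedy_digits a m M b \<longleftrightarrow>
     (\<forall>i. i \<notin> {m..M} \<longrightarrow> b i = 0) \<and> (\<forall>i. 0 \<le> b i \<and> b i \<le> a) \<and> (\<forall>i. b i = a \<longrightarrow> b (i - 1) = 0)"

definition has_greedy_expansion :: "real \<Rightarrow> int \<Rightarrow> real \<Rightarrow> int \<Rightarrow> bool" where
  "has_greedy_expansion \<theta> a \<alpha> m \<longleftrightarrow>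
     (\<exists>M b. m \<le> M \<and> greedy_digits a m M b \<and> b m \<noteq> 0 \<and>
        (let v = (\<Sum>i=m..M. of_int (b i) * \<theta> powi i) in \<alpha> = v \<or> \<alpha> = - v))"

text \<open>
  Finite greedy expansions represent exactly the nonzero elements of \<open>\<int>[\<theta>]\<close>, which for some \<open>\<theta>\<close>
  (for instance \<open>\<theta> = 4 + sqrt 17\<close>) is a proper subring of the ring of integers. A nonzero number
  without such an expansion gets the value \<open>\<infinity>\<close>; whenever every nonzero integer has one, the value
  \<open>\<infinity>\<close> does not occur on the ring of integers.
\<close>

definition theta_abs :: "real \<Rightarrow> int \<Rightarrow> real \<Rightarrow> ereal" where
  "theta_abs \<theta> a \<alpha> =
     (if \<alpha> = 0 then 0
      else if \<exists>m. has_greedy_expansion \<theta> a \<alpha> m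
        then ereal (\<theta> powi (- (THE m. has_greedy_expansion \<theta> a \<alpha> m)))
      else \<infinity>)"

definition theta_Cauchy :: "real \<Rightarrow> int \<Rightarrow> (nat \<Rightarrow> real) \<Rightarrow> bool" where
  "theta_Cauchy \<theta> a f \<longleftrightarrow>
     (\<forall>\<epsilon>>0. \<exists>N. \<forall>i\<ge>N. \<forall>j\<ge>N. theta_abs \<theta> a (f i - f j) < ereal \<epsilon>)"

definition Cauchy_ring :: "real \<Rightarrow> int \<Rightarrow> (nat \<Rightarrow> real) ring" where
  "Cauchy_ring \<theta> a =
     \<lparr>carrier = {f. (\<forall>n. f n \<in> ring_of_integers \<theta>) \<and> theta_Cauchy \<theta> a f},
      mult = (\<lambda>f g n. f n * g n), one = (\<lambda>n. 1),
      zero = (\<lambda>n. 0), add = (\<lambda>f g n. f n + g n)\<rparr>"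

definition null_ideal :: "real \<Rightarrow> int \<Rightarrow> (nat \<Rightarrow> real) set" where
  "null_ideal \<theta> a = {f \<in> carrier (Cauchy_ring \<theta> a). (\<lambda>n. theta_abs \<theta> a (f n)) \<longlonglongrightarrow> 0}"

definition theta_completion :: "real \<Rightarrow> int \<Rightarrow> (nat \<Rightarrow> real) set ring" where
  "theta_completion \<theta> a = Cauchy_ring \<theta> a Quot null_ideal \<theta> a"

text \<open>
  An element of the completion is a coset, i.e. the set of all Cauchy sequences representing it.
  The operator \<open>GREATEST\<close> denotes a maximum that is attained; for a set without a greatest element
  its value is unspecified.
\<close>

definition completion_abs :: "real \<Rightarrow> int \<Rightarrow> (nat \<Rightarrow> real) set \<Rightarrow> ereal" where
  "completion_abs \<theta> a H = (GREATEST v. \<exists>h\<in>H. v = limsup (\<lambda>i. theta_abs \<theta> a (h i)))"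

end

theory Submission
  imports Defs "Jordan_Normal_Form.Char_Poly"
begin

text \<open>
  The conjugate \<open>\<theta>' = - 1 / \<theta>\<close> reads a greedy polynomial from its lowest digit. If \<open>x\<close> has lowest exponent
  \<open>m\<close>, then \<open>x' = sgn x (-1)\<^sup>m s \<theta>\<^sup>-\<^sup>m\<close> with \<open>1 / \<theta> < s < \<theta>\<close>. So the absolute value of \<open>x\<close> is determined
  by the size of \<open>x'\<close> and one sign, and comparing \<open>x' - y'\<close> with \<open>x'\<close> and \<open>y'\<close> gives the pointwise
  inequality with the constant \<open>\<theta>\<^sup>2\<close>. It passes to the completion because the possible limits
  superior, \<open>0\<close>, \<open>\<infinity>\<close> and the powers of \<open>\<theta>\<close>, have no accumulation point other than \<open>0\<close> and \<open>\<infinity>\<close>, so that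
  the maximum over a coset is attained.
\<close>

subsection \<open>Sums of algebraic integers\<close>

text \<open>The characteristic polynomial of an integer matrix is monic with integer coefficients
  and vanishes at every eigenvalue.\<close>

lemma algebraic_int_of_int_eigenvector:
  fixes x :: "'a :: field_char_0" and v :: "nat \<Rightarrow> 'a" and A :: "nat \<Rightarrow> nat \<Rightarrow> int"
  assumes eig: "\<And>k. k < n \<Longrightarrow> x * v k = (\<Sum>l<n. of_int (A k l) * v l)"
    and nz: "k0 < n" "v k0 \<noteq> 0"
  shows "algebraic_int x"
proof -
  define M where "M = mat n n (\<lambda>(k, l). A k l)"
  define N where "N = (of_int_hom.mat_hom M :: 'a mat)"
  have M: "M \<in> carrier_mat n n" and N: "N \<in> carrier_mat n n"
    by (auto simp: M_def N_def)
  have "eigenvector N (vec n v) x"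
    unfolding eigenvector_def
  proof (intro conjI)
    show "vec n v \<in> carrier_vec (dim_row N)"
      using N by auto
    show "vec n v \<noteq> 0\<^sub>v (dim_row N)"
      using nz N by (metis carrier_matD(1) index_vec index_zero_vec(1))
    show "N *\<^sub>v vec n v = x \<cdot>\<^sub>v vec n v"
      by (rule eq_vecI) (auto simp: N_def M_def scalar_prod_def eig atLeast0LessThan)
  qed
  then have "poly (char_poly N) x = 0"
    using eigenvalue_root_char_poly[OF N] by (auto simp: eigenvalue_def)
  then have "poly (of_int_poly (char_poly M)) x = 0"
    by (simp add: N_def of_int_hom.char_poly_hom[OF M])
  moreover have "lead_coeff (char_poly M) = 1"
    using degree_monic_char_poly[OF M] by auto
  ultimately show ?thesis
    unfolding algebraic_int_altdef_ipoly by blast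
qed

lemma algebraic_int_power_relation:
  fixes x :: "'a :: field_char_0"
  assumes "algebraic_int x"
  obtains m c where "m > 0" "x ^ m = (\<Sum>i<m. of_int (c i) * x ^ i)"
proof -
  obtain p where p: "poly (of_int_poly p) x = 0" "lead_coeff p = 1"
    using assms unfolding algebraic_int_altdef_ipoly by blast
  have "degree p > 0"
    using p by (intro Nat.gr0I) (auto elim!: degree_eq_zeroE)
  moreover have "x ^ degree p = (\<Sum>i<degree p. of_int (- coeff p i) * x ^ i)"
  proof -
    have "0 = (\<Sum>i\<le>degree p. of_int (coeff p i) * x ^ i)"
      using p(1) by (simp add: poly_altdef)
    also have "\<dots> = (\<Sum>i<degree p. of_int (coeff p i) * x ^ i) + x ^ degree p"
      using p(2) by (simp flip: lessThan_Suc_atMost)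
    finally show ?thesis
      by (simp add: sum_negf add_eq_0_iff)
  qed
  ultimately show ?thesis by (rule that)
qed

text \<open>The products \<open>x ^ i * y ^ j\<close> with \<open>i < m\<close>,
  \<open>j < n\<close> span a finitely generated group that is stable under multiplication by
  \<open>x + y\<close>. The matrix of this multiplication is the Kronecker sum of the companion
  matrices of the two relations.\<close>

lemma algebraic_int_add:
  fixes x y :: "'a :: field_char_0"
  assumes "algebraic_int x" "algebraic_int y"
  shows "algebraic_int (x + y)"
proof -
  obtain m c where m: "m > 0" and x: "x ^ m = (\<Sum>i<m. of_int (c i) * x ^ i)"
    using algebraic_int_power_relation[OF assms(1)] .
  obtain n d where n: "n > 0" and y: "y ^ n = (\<Sum>i<n. of_int (d i) * y ^ i)"
    using algebraic_int_power_relation[OF assms(2)] .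
  \<comment> \<open>Companion matrices: all rows but the last raise the exponent by one, and the
    last row applies the monic relation.\<close>
  define C where "C i i' = (if Suc i < m then if i' = Suc i then 1 else 0 else c i')" for i i' :: nat
  define D where "D j j' = (if Suc j < n then if j' = Suc j then 1 else 0 else d j')" for j j' :: nat
  have C: "x * x ^ i = (\<Sum>i'<m. of_int (C i i') * x ^ i')" if "i < m" for i
  proof (cases "Suc i < m")
    case False
    then have "Suc i = m" using that by simp
    then show ?thesis using x by (auto simp: C_def)
  qed (simp add: C_def if_distrib[of of_int] if_distrib[of "\<lambda>t. t * _"] cong: if_cong)
  have D: "y * y ^ j = (\<Sum>j'<n. of_int (D j j') * y ^ j')" if "j < n" for j
  proof (cases "Suc j < n")
    case False
    then have "Suc j = n" using that by simp
    then show ?thesis using y by (auto simp: D_def)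
  qed (simp add: D_def if_distrib[of of_int] if_distrib[of "\<lambda>t. t * _"] cong: if_cong)
  \<comment> \<open>The pair \<open>(i, j)\<close> is coded as \<open>i * n + j\<close>, so
    \<open>div\<close> and \<open>mod\<close> recover the exponents of \<open>x\<close> and
    \<open>y\<close>.\<close>
  define A where "A k l = (if l mod n = k mod n then C (k div n) (l div n) else 0)
    + (if l div n = k div n then D (k mod n) (l mod n) else 0)" for k l
  define v where "v k = x ^ (k div n) * y ^ (k mod n)" for k
  have sum_split: "(\<Sum>l<m * n. g (l div n) (l mod n)) = (\<Sum>i<m. \<Sum>j<n. g i j)"
    for g :: "nat \<Rightarrow> nat \<Rightarrow> 'a"
  proof -
    have "i * n + j < m * n" if "i < m" "j < n" for i j
    proof -
      have "i * n + j < Suc i * n" using that by simp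
      also have "\<dots> \<le> m * n" using that by (intro mult_le_mono1) simp
      finally show ?thesis .
    qed
    then show ?thesis
      using n unfolding sum.cartesian_product
      by (intro sum.reindex_bij_witness[where i = "\<lambda>(i, j). i * n + j" and j = "\<lambda>l. (l div n, l mod n)"])
         (auto simp: less_mult_imp_div_less)
  qed
  show ?thesis
  proof (rule algebraic_int_of_int_eigenvector)
    \<comment> \<open>Index \<open>0\<close> stands for the product 1, which is nonzero even if
      \<open>x\<close> or \<open>y\<close> vanishes.\<close>
    show "0 < m * n" "v 0 \<noteq> 0" using m n by (auto simp: v_def)
    fix k assume k: "k < m * n"
    define i j where "i = k div n" and "j = k mod n"
    have ij: "i < m" "j < n"
      using k n by (auto simp: i_def j_def less_mult_imp_div_less)
    have "(\<Sum>l<m * n. of_int (A k l) * v l) =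
        (\<Sum>i'<m. \<Sum>j'<n. of_int ((if j' = j then C i i' else 0) + (if i' = i then D j j' else 0))
           * (x ^ i' * y ^ j'))"
      unfolding A_def v_def i_def[symmetric] j_def[symmetric] by (rule sum_split)
    also have "\<dots> = (\<Sum>i'<m. \<Sum>j'<n. if j' = j then of_int (C i i') * (x ^ i' * y ^ j') else 0)
        + (\<Sum>i'<m. \<Sum>j'<n. if i' = i then of_int (D j j') * (x ^ i' * y ^ j') else 0)"
      unfolding sum.distrib[symmetric] by (intro sum.cong) (auto simp: algebra_simps)
    also have "(\<Sum>i'<m. \<Sum>j'<n. if j' = j then of_int (C i i') * (x ^ i' * y ^ j') else 0)
        = (\<Sum>i'<m. of_int (C i i') * x ^ i') * y ^ j"
      using ij by (simp add: sum_distrib_right mult.assoc)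
    also have "(\<Sum>i'<m. \<Sum>j'<n. if i' = i then of_int (D j j') * (x ^ i' * y ^ j') else 0)
        = x ^ i * (\<Sum>j'<n. of_int (D j j') * y ^ j')"
      using ij by (subst sum.swap) (simp add: sum_distrib_left ac_simps)
    also have "(\<Sum>i'<m. of_int (C i i') * x ^ i') * y ^ j + x ^ i * (\<Sum>j'<n. of_int (D j j') * y ^ j')
        = (x + y) * v k"
      unfolding C[OF ij(1), symmetric] D[OF ij(2), symmetric]
      by (simp add: v_def i_def j_def algebra_simps)
    finally show "(x + y) * v k = (\<Sum>l<m * n. of_int (A k l) * v l)"
      by simp
  qed
qed

lemma ring_of_integers_add:
  assumes "x \<in> ring_of_integers \<theta>" "y \<in> ring_of_integers \<theta>"
  shows "x + y \<in> ring_of_integers \<theta>"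
proof -
  have "x + y \<in> F"
    if "\<theta> \<in> F \<and> 1 \<in> F \<and> (\<forall>x\<in>F. \<forall>y\<in>F. x - y \<in> F \<and> x * y \<in> F) \<and> (\<forall>x\<in>F. inverse x \<in> F)" for F
  proof -
    have xy: "x \<in> F" "y \<in> F"
      using assms that by (auto simp: ring_of_integers_def generated_subfield_def)
    then have "0 \<in> F" using that by (metis diff_self)
    then have "x - (0 - y) \<in> F" using that xy by blast
    then show ?thesis by simp
  qed
  then show ?thesis
    using assms by (auto simp: ring_of_integers_def generated_subfield_def intro: algebraic_int_add)
qed

lemma zero_in_ring_of_integers: "0 \<in> ring_of_integers \<theta>"
  by (auto simp: ring_of_integers_def generated_subfield_def) (metis diff_self)

lemma ring_of_integers_uminus:
  assumes "x \<in> ring_of_integers \<theta>"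
  shows "- x \<in> ring_of_integers \<theta>"
proof -
  have "- x \<in> F"
    if "\<theta> \<in> F \<and> 1 \<in> F \<and> (\<forall>x\<in>F. \<forall>y\<in>F. x - y \<in> F \<and> x * y \<in> F) \<and> (\<forall>x\<in>F. inverse x \<in> F)" for F
  proof -
    have "x \<in> F" "0 \<in> F"
      using assms zero_in_ring_of_integers[of \<theta>] that
      by (auto simp: ring_of_integers_def generated_subfield_def)
    then have "0 - x \<in> F" using that by blast
    then show ?thesis by simp
  qed
  then show ?thesis
    using assms by (auto simp: ring_of_integers_def generated_subfield_def)
qed

subsection \<open>Greedy expansions and conjugates\<close>

text \<open>For irrational \<open>\<theta>\<close> with \<open>\<theta>\<^sup>2 = a \<theta> + 1\<close>: \<open>x \<in> \<int>[\<theta>]\<close> and \<open>y\<close> is its Galois conjugate.\<close>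

definition conj_pair :: "real \<Rightarrow> real \<Rightarrow> real \<Rightarrow> bool" where
  "conj_pair \<theta> x y \<longleftrightarrow>
     (\<exists>p q :: int. x = of_int p + of_int q * \<theta> \<and> y = of_int p - of_int q / \<theta>)"

locale negative_norm_unit =
  fixes \<theta> :: real and a :: int
  assumes gt_1: "\<theta> > 1" and unit: "quadratic_unit \<theta> a (-1)"
begin

lemma pos: "\<theta> > 0"
  using gt_1 by simp

lemma a_ge_1: "a \<ge> 1" and sq: "\<theta>\<^sup>2 = of_int a * \<theta> + 1"
  using unit quadratic_unit_norm_minus_one_iff[OF gt_1] by auto

lemma inverse_eq: "1 / \<theta> = \<theta> - of_int a"
  using sq pos by (simp add: field_simps power2_eq_square)

lemma less_a_plus_1: "\<theta> < of_int a + 1"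
proof -
  have "1 / \<theta> < 1" using gt_1 by simp
  then show ?thesis using inverse_eq by linarith
qed

lemma powi_mono: "i \<le> j \<Longrightarrow> \<theta> powi i \<le> \<theta> powi j" and powi_strict_mono: "i < j \<Longrightarrow> \<theta> powi i < \<theta> powi j"
  using gt_1 by (auto intro: power_int_increasing power_int_strict_increasing)

lemma powi_less_iff: "\<theta> powi i < \<theta> powi j \<longleftrightarrow> i < j"
  using powi_mono[of j i] powi_strict_mono[of i j] by linarith

lemma powi_pos: "\<theta> powi i > 0"
  using pos by simp

text \<open>Since \<theta> is irrational, 1 and \<theta> are linearly independent over the
  rationals, so the coefficients \<open>p\<close> and \<open>q\<close> are determined by
  \<open>x\<close>.\<close>

lemma conj_pair_unique:
  assumes "conj_pair \<theta> x y" "conj_pair \<theta> x z"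
  shows "y = z"
proof -
  obtain p q p' q' :: int where *: "x = of_int p + of_int q * \<theta>" "y = of_int p - of_int q / \<theta>"
    "x = of_int p' + of_int q' * \<theta>" "z = of_int p' - of_int q' / \<theta>"
    using assms unfolding conj_pair_def by blast
  have "q = q'"
  proof (rule ccontr)
    assume "q \<noteq> q'"
    then have "\<theta> = (of_int p' - of_int p) / (of_int q - of_int q')"
      using * by (simp add: field_simps)
    also have "\<dots> \<in> \<rat>" by simp
    finally show False using unit by (simp add: quadratic_unit_def)
  qed
  with * show ?thesis by simp
qed

section \<open>Conjugation respects the ring operations\<close>

lemma conj_pair_add: "conj_pair \<theta> x y \<Longrightarrow> conj_pair \<theta> x' y' \<Longrightarrow> conj_pair \<theta> (x + x') (y + y')"
  unfolding conj_pair_def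
proof (elim exE conjE)
  fix p q p' q' :: int
  assume "x = of_int p + of_int q * \<theta>" "y = of_int p - of_int q / \<theta>"
    "x' = of_int p' + of_int q' * \<theta>" "y' = of_int p' - of_int q' / \<theta>"
  then show "\<exists>p q :: int. x + x' = of_int p + of_int q * \<theta> \<and> y + y' = of_int p - of_int q / \<theta>"
    by (intro exI[of _ "p + p'"] exI[of _ "q + q'"]) (simp add: algebra_simps add_divide_distrib)
qed

text \<open>Both \<theta> and \<open>- 1 / \<theta>\<close> are roots of
  \<open>X^2 - a X - 1\<close>, so reducing the quadratic term of either product leads to the same
  integer coefficients.\<close>

lemma conj_pair_mult: "conj_pair \<theta> x y \<Longrightarrow> conj_pair \<theta> x' y' \<Longrightarrow> conj_pair \<theta> (x * x') (y * y')"
  unfolding conj_pair_def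
proof (elim exE conjE)
  fix p q p' q' :: int
  assume *: "x = of_int p + of_int q * \<theta>" "y = of_int p - of_int q / \<theta>"
    "x' = of_int p' + of_int q' * \<theta>" "y' = of_int p' - of_int q' / \<theta>"
  have sq': "\<theta> * \<theta> = of_int a * \<theta> + 1"
    using sq by (simp add: power2_eq_square)
  have inv_sq: "1 / \<theta> * (1 / \<theta>) = 1 - of_int a * (1 / \<theta>)"
    using arg_cong[OF inverse_eq, of "\<lambda>t. t * (1 / \<theta>)"] pos by (simp add: left_diff_distrib diff_divide_distrib)
  have "x * x' = of_int (p * p') + of_int (p * q' + q * p') * \<theta> + of_int (q * q') * (\<theta> * \<theta>)"
    by (simp add: * algebra_simps)
  moreover have "y * y' = of_int (p * p') - of_int (p * q' + q * p') * (1 / \<theta>)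
      + of_int (q * q') * (1 / \<theta> * (1 / \<theta>))"
    by (simp add: * algebra_simps add_divide_distrib)
  ultimately show "\<exists>p q :: int. x * x' = of_int p + of_int q * \<theta> \<and> y * y' = of_int p - of_int q / \<theta>"
    unfolding sq' inv_sq
    by (intro exI[of _ "p * p' + q * q'"] exI[of _ "p * q' + q * p' + a * (q * q')"])
       (simp add: algebra_simps add_divide_distrib)
qed

lemma conj_pair_of_int: "conj_pair \<theta> (of_int k) (of_int k)"
  unfolding conj_pair_def by (intro exI[of _ k] exI[of _ 0]) simp

lemma conj_pair_uminus: "conj_pair \<theta> x y \<Longrightarrow> conj_pair \<theta> (- x) (- y)"
  using conj_pair_mult[OF conj_pair_of_int[of "-1"]] by simp

lemma conj_pair_diff: "conj_pair \<theta> x y \<Longrightarrow> conj_pair \<theta> x' y' \<Longrightarrow> conj_pair \<theta> (x - x') (y - y')"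
  using conj_pair_add[OF _ conj_pair_uminus, of x y x' y'] by simp

lemma conj_pair_theta: "conj_pair \<theta> \<theta> (- 1 / \<theta>)"
  unfolding conj_pair_def by (intro exI[of _ 0] exI[of _ 1]) simp

lemma conj_pair_inverse_theta: "conj_pair \<theta> (1 / \<theta>) (- \<theta>)"
  unfolding conj_pair_def using inverse_eq by (intro exI[of _ "- a"] exI[of _ 1]) simp

text \<open>Negative exponents stay inside the ring because
  \<open>1 / \<theta> = \<theta> - a\<close>; they get an induction of their own.\<close>

lemma conj_pair_powi: "conj_pair \<theta> (\<theta> powi k) ((- 1 / \<theta>) powi k)"
proof -
  have "conj_pair \<theta> (\<theta> ^ n) ((- 1 / \<theta>) ^ n)" for n
  proof (induction n)
    case (Suc n)
    then show ?case using conj_pair_mult[OF conj_pair_theta Suc] by simp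
  qed (use conj_pair_of_int[of 1] in simp)
  moreover have "conj_pair \<theta> ((1 / \<theta>) ^ n) ((- \<theta>) ^ n)" for n
  proof (induction n)
    case (Suc n)
    then show ?case using conj_pair_mult[OF conj_pair_inverse_theta Suc] by simp
  qed (use conj_pair_of_int[of 1] in simp)
  ultimately show ?thesis
    by (auto simp: power_int_def inverse_eq_divide)
qed

lemma conj_pair_sum:
  "(\<And>i. i \<in> S \<Longrightarrow> conj_pair \<theta> (f i) (g i)) \<Longrightarrow> conj_pair \<theta> (sum f S) (sum g S)"
proof (induction S rule: infinite_finite_induct)
  case (insert i S)
  then show ?case by (simp add: conj_pair_add)
qed (use conj_pair_of_int[of 0] in simp_all)

section \<open>Bounds on the conjugates of greedy polynomials\<close>

definition alternating_sum :: "(int \<Rightarrow> int) \<Rightarrow> int \<Rightarrow> nat \<Rightarrow> real" where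
  "alternating_sum b m n = (\<Sum>j<n. of_int (b (m + int j)) * (- 1 / \<theta>) ^ j)"

lemma alternating_sum_0 [simp]: "alternating_sum b m 0 = 0"
  by (simp add: alternating_sum_def)

lemma alternating_sum_Suc:
  "alternating_sum b m (Suc n) = of_int (b m) - alternating_sum b (m + 1) n / \<theta>"
  unfolding alternating_sum_def
  by (subst sum.lessThan_Suc_shift)
     (simp add: sum_divide_distrib sum_negf algebra_simps)

context
  fixes b :: "int \<Rightarrow> int"
  assumes digits: "\<And>i. 0 \<le> b i \<and> b i \<le> a" and admissible: "\<And>i. b i = a \<Longrightarrow> b (i - 1) = 0"
begin

text \<open>The interval from \<open>-1\<close> to \<theta> is stable under prepending a digit,
  \<open>s\<close> to \<open>d - s / \<theta>\<close> with \<open>0 \<le> d \<le> a\<close>. The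
  upper end reproduces itself because \<open>a + 1 / \<theta> = \<theta>\<close>.\<close>

lemma alternating_sum_bounds: "- 1 < alternating_sum b m n \<and> alternating_sum b m n < \<theta>"
proof (induction n arbitrary: m)
  case (Suc n)
  let ?s = "alternating_sum b (m + 1) n"
  have "- 1 / \<theta> < ?s / \<theta>"
    using Suc[of "m + 1"] pos by (intro divide_strict_right_mono) auto
  moreover have "?s / \<theta> < 1"
    using Suc[of "m + 1"] pos by simp
  moreover have "real_of_int (b m) \<ge> 0" "real_of_int (b m) \<le> of_int a"
    using digits by auto
  ultimately show ?case
    using inverse_eq by (auto simp: alternating_sum_Suc)
qed (use gt_1 in auto)

text \<open>Here the greedy condition enters: a nonzero lowest digit forces the next one to be at
  most \<open>a - 1\<close>. The tail is then below
  \<open>a - 1 + 1 / \<theta> = \<theta> - 1\<close>, and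
  \<open>1 - (\<theta> - 1) / \<theta> = 1 / \<theta>\<close>.\<close>

lemma alternating_sum_lower:
  assumes "b m \<noteq> 0" "n > 0"
  shows "1 / \<theta> < alternating_sum b m n"
proof -
  obtain n' where n: "n = Suc n'"
    using assms(2) gr0_conv_Suc by blast
  let ?s = "alternating_sum b (m + 1) n'"
  have "?s < \<theta> - 1"
  proof (cases n')
    case (Suc k)
    have "b (m + 1) \<noteq> a"
      using admissible[of "m + 1"] assms(1) by auto
    then have "b (m + 1) \<le> a - 1"
      using digits[of "m + 1"] by linarith
    then have "real_of_int (b (m + 1)) \<le> of_int a - 1"
      by linarith
    moreover have "- 1 / \<theta> < alternating_sum b (m + 1 + 1) k / \<theta>"
      using alternating_sum_bounds[of "m + 1 + 1" k] pos by (intro divide_strict_right_mono) auto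
    ultimately show ?thesis
      using inverse_eq by (simp add: Suc alternating_sum_Suc)
  qed (use gt_1 in auto)
  then have "?s / \<theta> < 1 - 1 / \<theta>"
    using pos by (simp add: field_simps)
  moreover have "real_of_int (b m) \<ge> 1"
    using assms(1) digits[of m] by linarith
  ultimately show ?thesis
    by (simp add: n alternating_sum_Suc)
qed

end

text \<open>Termwise conjugation turns each power of \<theta> into a power of
  \<open>- 1 / \<theta>\<close>; pulling out the lowest one leaves an alternating sum as
  \<open>s\<close>. The digit sum itself is positive, so \<open>sgn x\<close> tells which of the two
  signs was taken.\<close>

lemma greedy_expansion_conj:
  assumes "has_greedy_expansion \<theta> a x m"
  shows "\<exists>s. 1 / \<theta> < s \<and> s < \<theta> \<and> x \<noteq> 0 \<and>
    conj_pair \<theta> x (sgn x * (-1) powi m * s * \<theta> powi (- m))"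
proof -
  obtain M b where "m \<le> M" and b: "greedy_digits a m M b" "b m \<noteq> 0"
    and x: "x = (\<Sum>i=m..M. of_int (b i) * \<theta> powi i) \<or> x = - (\<Sum>i=m..M. of_int (b i) * \<theta> powi i)"
    using assms unfolding has_greedy_expansion_def Let_def by blast
  define v where "v = (\<Sum>i=m..M. of_int (b i) * \<theta> powi i)"
  \<comment> \<open>The number of digit positions; it is positive, as the lower bound on
    \<open>s\<close> requires.\<close>
  define n where "n = nat (M - m + 1)"
  define s where "s = alternating_sum b m n"
  have dig: "\<And>i. 0 \<le> b i \<and> b i \<le> a" "\<And>i. b i = a \<Longrightarrow> b (i - 1) = 0"
    using b by (auto simp: greedy_digits_def)
  have "b m > 0" using dig(1)[of m] b by linarith
  then have "v > 0"
    unfolding v_def using \<open>m \<le> M\<close> powi_pos dig(1)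
    by (intro sum_pos2[where i = m]) (auto intro!: mult_nonneg_nonneg simp: less_imp_le)
  have s: "1 / \<theta> < s" "s < \<theta>"
    using alternating_sum_lower[of b m n] alternating_sum_bounds[of b m n] dig b \<open>m \<le> M\<close>
    by (auto simp: s_def n_def)
  have "conj_pair \<theta> v (\<Sum>i=m..M. of_int (b i) * (- 1 / \<theta>) powi i)"
    unfolding v_def by (intro conj_pair_sum conj_pair_mult conj_pair_of_int conj_pair_powi)
  also have "(\<Sum>i=m..M. of_int (b i) * (- 1 / \<theta>) powi i)
      = (\<Sum>j<n. of_int (b (m + int j)) * (- 1 / \<theta>) powi (m + int j))"
    by (rule sum.reindex_bij_witness[where i = "\<lambda>j. m + int j" and j = "\<lambda>i. nat (i - m)"])
       (auto simp: n_def)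
  also have "\<dots> = (- 1 / \<theta>) powi m * s"
    unfolding s_def alternating_sum_def sum_distrib_left
    using pos by (intro sum.cong) (auto simp: power_int_add)
  also have "(- 1 / \<theta>) powi m = (-1) powi m * \<theta> powi (- m)"
    by (metis divide_inverse power_int_inverse power_int_minus power_int_mult_distrib)
  finally have conj: "conj_pair \<theta> v ((-1) powi m * s * \<theta> powi (- m))"
    by (simp add: mult_ac)
  from x[folded v_def] show ?thesis
  proof
    assume "x = v"
    then show ?thesis using s conj \<open>v > 0\<close> by (intro exI[of _ s]) simp
  next
    assume "x = - v"
    then show ?thesis
      using s conj_pair_uminus[OF conj] \<open>v > 0\<close> by (intro exI[of _ s]) simp
  qed
qed

text \<open>An exponent \<open>m\<close> confines the size of the conjugate to the open window from
  \<open>\<theta> powi (- m - 1)\<close> to \<open>\<theta> powi (1 - m)\<close>. Windows of two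
  different exponents meet only if these are neighbours, and then the factors
  \<open>(-1) powi m\<close> give opposite signs.\<close>

lemma greedy_expansion_unique:
  assumes "has_greedy_expansion \<theta> a x m" "has_greedy_expansion \<theta> a x n"
  shows "m = n"
proof -
  have "\<not> m < n" if m: "has_greedy_expansion \<theta> a x m" and n: "has_greedy_expansion \<theta> a x n" for m n
  proof
    assume "m < n"
    obtain s where s: "1 / \<theta> < s" "s < \<theta>" "x \<noteq> 0"
      "conj_pair \<theta> x (sgn x * (-1) powi m * s * \<theta> powi (- m))"
      using greedy_expansion_conj[OF m] by blast
    obtain t where t: "1 / \<theta> < t" "t < \<theta>"
      "conj_pair \<theta> x (sgn x * (-1) powi n * t * \<theta> powi (- n))"
      using greedy_expansion_conj[OF n] by blast
    have eq: "(-1) powi m * s * \<theta> powi (- m) = (-1) powi n * t * \<theta> powi (- n)"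
      using conj_pair_unique[OF s(4) t(3)] s(3) by (simp add: sgn_0_0 mult.assoc)
    have "1 / \<theta> > 0" using pos by simp
    then have "s > 0" "t > 0" using s t by linarith+
    have abs1: "\<bar>(-1::real) powi k\<bar> = 1" for k by (simp add: power_int_abs)
    have "s * \<theta> powi (- m) = t * \<theta> powi (- n)"
      using arg_cong[OF eq, of abs] \<open>s > 0\<close> \<open>t > 0\<close> powi_pos
      by (simp add: abs_mult abs1 less_imp_le)
    moreover have "\<theta> powi (- m - 1) < s * \<theta> powi (- m)"
      using mult_strict_right_mono[OF s(1) powi_pos[of "- m"]] pos
      by (simp add: power_int_diff)
    moreover have "t * \<theta> powi (- n) < \<theta> powi (1 - n)"
      using mult_strict_right_mono[OF t(2) powi_pos[of "- n"]] pos
      by (simp add: power_int_diff power_int_minus_divide)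
    ultimately have "\<theta> powi (- m - 1) < \<theta> powi (1 - n)" by linarith
    then have "n = m + 1" using \<open>m < n\<close> by (simp add: powi_less_iff)
    then have "(-1::real) powi n = - ((-1) powi m)"
      by (simp add: power_int_add)
    with eq have "s * \<theta> powi (- m) = - (t * \<theta> powi (- n))"
      by (metis abs1 abs_zero mult.assoc mult_cancel_left mult_minus_left mult_minus_right zero_neq_one)
    then show False
      using mult_pos_pos[OF \<open>s > 0\<close> powi_pos[of "- m"]] mult_pos_pos[OF \<open>t > 0\<close> powi_pos[of "- n"]]
      by linarith
  qed
  with assms show ?thesis by (metis linorder_neqE)
qed

section \<open>Existence of finite greedy expansions\<close>

lemma greedy_digits_shift:
  assumes "greedy_digits a m M b"
  shows "greedy_digits a (m + k) (M + k) (\<lambda>i. b (i - k))"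
    and "(\<Sum>i=m+k..M+k. of_int (b (i - k)) * \<theta> powi i) = \<theta> powi k * (\<Sum>i=m..M. of_int (b i) * \<theta> powi i)"
proof -
  show "greedy_digits a (m + k) (M + k) (\<lambda>i. b (i - k))"
    using assms by (auto simp: greedy_digits_def algebra_simps)
  have "(\<Sum>i=m+k..M+k. of_int (b (i - k)) * \<theta> powi i)
      = (\<Sum>i=m..M. of_int (b i) * \<theta> powi (i + k))"
    by (rule sum.reindex_bij_witness[where i = "\<lambda>i. i + k" and j = "\<lambda>i. i - k"]) auto
  then show "(\<Sum>i=m+k..M+k. of_int (b (i - k)) * \<theta> powi i)
      = \<theta> powi k * (\<Sum>i=m..M. of_int (b i) * \<theta> powi i)"
    using pos by (simp add: sum_distrib_left power_int_add mult_ac)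
qed

text \<open>
  Stripping the top digit of \<open>u\<close> replaces the conjugate \<open>v\<close> by \<open>- v / \<theta> - b\<close>. This maps the interval
  \<open>[-\<theta> - e, 1 + e]\<close> into \<open>[-\<theta> - e / \<theta>, 1 + e / \<theta>]\<close>, and for small \<open>e\<close> only \<open>u = 0\<close> and \<open>u = 1 / \<theta>\<close>
  have their conjugate there.
\<close>

lemma greedy_digits_exist:
  assumes "conj_pair \<theta> u v" "0 \<le> u" "u < 1" "- \<theta> - \<theta> ^ n / \<theta> \<le> v" "v \<le> 1 + \<theta> ^ n / \<theta>"
  shows "\<exists>m b. m \<le> -1 \<and> greedy_digits a m (-1) b \<and> u = (\<Sum>i=m..-1. of_int (b i) * \<theta> powi i)"
  using assms
proof (induction n arbitrary: u v)
  case 0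
  obtain p q :: int where u: "u = of_int p + of_int q * \<theta>" and v: "v = of_int p - of_int q / \<theta>"
    using 0(1) unfolding conj_pair_def by blast
  \<comment> \<open>For \<open>n = 0\<close> the slack \<open>e\<close> is
    \<open>1 / \<theta>\<close>. The bounds then place \<open>u - v\<close> strictly between
    \<open>-1\<close> and \<open>2\<close> times \<open>\<theta> + 1 / \<theta>\<close>, which
    leaves two values of \<open>q\<close>.\<close>
  have uv: "u - v = of_int q * (\<theta> + 1 / \<theta>)"
    by (simp add: u v algebra_simps)
  have "1 / \<theta> > 0" using pos by simp
  have "- \<theta> - 1 / \<theta> \<le> v"
    using 0(4) by simp
  then have "u - v < (\<theta> + 1 / \<theta>) + (\<theta> + 1 / \<theta>)"
    using 0(3) gt_1 \<open>1 / \<theta> > 0\<close> by linarith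
  then have "of_int q * (\<theta> + 1 / \<theta>) < 2 * (\<theta> + 1 / \<theta>)"
    by (simp only: uv mult_2)
  then have "real_of_int q < 2"
    by (rule mult_right_less_imp_less) (use pos in simp)
  have "v \<le> 1 + 1 / \<theta>"
    using 0(5) by simp
  then have "- (\<theta> + 1 / \<theta>) < u - v"
    using 0(2) gt_1 by linarith
  then have "(-1) * (\<theta> + 1 / \<theta>) < of_int q * (\<theta> + 1 / \<theta>)"
    by (simp only: uv mult_minus1)
  then have "-1 < real_of_int q"
    by (rule mult_right_less_imp_less) (use pos in simp)
  then consider "q = 0" | "q = 1"
    using \<open>real_of_int q < 2\<close> by linarith
  then show ?case
  proof cases
    case 1
    then have "u = 0" using u 0 by simp
    then show ?thesis
      using a_ge_1 by (intro exI[of _ "-1"] exI[of _ "\<lambda>_. 0"]) (auto simp: greedy_digits_def)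
  next
    case 2
    then have eq: "u = of_int (p + a) + 1 / \<theta>"
      using u inverse_eq by simp
    moreover have "1 / \<theta> < 1" using gt_1 by simp
    ultimately have "real_of_int (p + a) < 1" "real_of_int (p + a) > -1"
      using 0 \<open>1 / \<theta> > 0\<close> by linarith+
    then have "p + a = 0" by linarith
    then have "u = 1 / \<theta>" using eq by simp
    then show ?thesis
      using a_ge_1
      by (intro exI[of _ "-1"] exI[of _ "\<lambda>i. if i = -1 then 1 else 0"])
         (auto simp: greedy_digits_def power_int_minus inverse_eq_divide)
  qed
next
  case (Suc n)
  define d where "d = \<lfloor>u * \<theta>\<rfloor>"
  define w where "w = u * \<theta> - of_int d"
  have w: "0 \<le> w" "w < 1"
    unfolding w_def d_def by linarith+
  have "0 \<le> u * \<theta>" "u * \<theta> < \<theta>"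
    using Suc.prems pos by auto
  then have d: "0 \<le> d" "d \<le> a"
    using less_a_plus_1 unfolding d_def by (auto simp: floor_le_iff)
  then have d': "0 \<le> real_of_int d" "real_of_int d \<le> of_int a" by auto
  have "conj_pair \<theta> w (v * (- 1 / \<theta>) - of_int d)"
    unfolding w_def
    by (intro conj_pair_diff conj_pair_mult conj_pair_theta conj_pair_of_int Suc.prems)
  \<comment> \<open>The slack for \<open>Suc n\<close> is \<open>\<theta> ^ n\<close>; dividing by
    \<theta> gives exactly the slack in the induction hypothesis.\<close>
  moreover have "(- \<theta> - \<theta> ^ n) / \<theta> \<le> v / \<theta>" "v / \<theta> \<le> (1 + \<theta> ^ n) / \<theta>"
    using Suc.prems pos by (auto intro!: divide_right_mono)
  then have "- 1 - \<theta> ^ n / \<theta> \<le> v / \<theta>" "v / \<theta> \<le> 1 / \<theta> + \<theta> ^ n / \<theta>"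
    using pos by (simp_all add: diff_divide_distrib add_divide_distrib)
  then have "- \<theta> - \<theta> ^ n / \<theta> \<le> v * (- 1 / \<theta>) - of_int d" "v * (- 1 / \<theta>) - of_int d \<le> 1 + \<theta> ^ n / \<theta>"
    unfolding mult_minus_right times_divide_eq_right mult_1_right minus_divide_left[symmetric]
    using d' inverse_eq by linarith+
  ultimately obtain m c where m: "m \<le> -1" and c: "greedy_digits a m (-1) c"
    and w_eq: "w = (\<Sum>i=m..-1. of_int (c i) * \<theta> powi i)"
    using Suc.IH w by blast
  define b where "b = (\<lambda>i. c (i + 1))(-1 := d)"
  have c0: "c i = 0" if "i \<notin> {m..-1}" for i
    using c that unfolding greedy_digits_def by blast
  \<comment> \<open>If the top digit is \<open>a\<close>, then
    \<open>w < \<theta> - a = 1 / \<theta>\<close>, which leaves no room for a nonzero digit at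
    position \<open>-1\<close> of \<open>w\<close>.\<close>
  have "c (-1) = 0" if "d = a"
  proof -
    have "w < \<theta> powi (-1)"
      using \<open>u * \<theta> < \<theta>\<close> that inverse_eq by (simp add: w_def power_int_minus inverse_eq_divide)
    moreover have "of_int (c (-1)) * \<theta> powi (-1) \<le> w"
      unfolding w_eq using c m pos by (intro member_le_sum) (auto simp: greedy_digits_def)
    ultimately have "of_int (c (-1)) * \<theta> powi (-1) < 1 * \<theta> powi (-1)" by simp
    then have "real_of_int (c (-1)) < 1"
      by (rule mult_right_less_imp_less) (use powi_pos[of "-1"] in simp)
    moreover have "c (-1) \<ge> 0" using c by (simp add: greedy_digits_def)
    ultimately show ?thesis by linarith
  qed
  moreover have "b (-2) = c (-1)" "b i = c (i + 1)" if "i \<noteq> -1" for i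
    using that by (auto simp: b_def)
  ultimately have "greedy_digits a (m - 1) (-1) b"
    unfolding greedy_digits_def
  proof (intro conjI allI impI)
    fix i assume *: "d = a \<Longrightarrow> c (- 1) = 0"
    show "b i = 0" if "i \<notin> {m - 1..-1}"
      using that m c0[of "i + 1"] by (auto simp: b_def)
    show "0 \<le> b i" "b i \<le> a"
      using c d by (auto simp: b_def greedy_digits_def)
    \<comment> \<open>The case \<open>i = 0\<close> is special: the digit below is \<open>d\<close>,
      which may be nonzero, but \<open>b 0 = c 1 = 0\<close> differs from \<open>a\<close> because
      \<open>a \<ge> 1\<close>.\<close>
    show "b (i - 1) = 0" if "b i = a"
    proof -
      have "c i = 0" if "c (i + 1) = a"
        using c that unfolding greedy_digits_def by (metis add_diff_cancel_right')
      then show ?thesis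
        using \<open>b i = a\<close> * m c0[of 0] c0[of 1] a_ge_1 by (auto simp: b_def split: if_splits)
    qed
  qed
  moreover have "u = (\<Sum>i=m-1..-1. of_int (b i) * \<theta> powi i)"
  proof -
    have "{m-1..-1} = insert (-1) {m-1..-2}"
      using m by auto
    then have "(\<Sum>i=m-1..-1. of_int (b i) * \<theta> powi i)
        = of_int d / \<theta> + (\<Sum>i=m-1..-2. of_int (b i) * \<theta> powi i)"
      by (simp add: b_def power_int_minus divide_inverse)
    also have "(\<Sum>i=m-1..-2. of_int (b i) * \<theta> powi i)
        = (\<Sum>i=m+-1..-1+-1. of_int (c (i - -1)) * \<theta> powi i)"
      by (intro sum.cong) (auto simp: b_def)
    also have "\<dots> = w / \<theta>"
      unfolding greedy_digits_shift(2)[OF c] w_eq[symmetric]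
      by (simp add: power_int_minus divide_inverse)
    also have "of_int d / \<theta> + w / \<theta> = u"
      using pos by (simp add: w_def field_simps)
    finally show ?thesis by simp
  qed
  ultimately show ?case
    using m by (intro exI[of _ "m - 1"] exI[of _ b]) auto
qed

lemma has_greedy_expansion_uminus:
  "has_greedy_expansion \<theta> a (- x) = has_greedy_expansion \<theta> a x"
proof -
  have "(- x = v \<or> - x = - v) = (x = v \<or> x = - v)" for v :: real by auto
  then show ?thesis unfolding has_greedy_expansion_def Let_def by simp
qed

text \<open>A power of \<theta> scales \<open>x\<close> below 1, and the slack for a large
  \<open>n\<close> admits the conjugate of the scaled number. The digits found are shifted
  back.\<close>

lemma greedy_expansion_exists_pos:
  assumes "conj_pair \<theta> x y" "x > 0"
  shows "\<exists>m. has_greedy_expansion \<theta> a x m"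
proof -
  obtain k where "x < \<theta> ^ k"
    using real_arch_pow[OF gt_1] by blast
  define u where "u = x * \<theta> powi (- int k)"
  define v where "v = y * (- 1 / \<theta>) powi (- int k)"
  have "conj_pair \<theta> u v"
    unfolding u_def v_def by (intro conj_pair_mult conj_pair_powi assms)
  moreover have "0 \<le> u" "u < 1"
    using assms \<open>x < \<theta> ^ k\<close> pos by (auto simp: u_def power_int_minus field_simps)
  moreover obtain n where "\<bar>v\<bar> * \<theta> < \<theta> ^ n"
    using real_arch_pow[OF gt_1] by blast
  then have "\<bar>v\<bar> < \<theta> ^ n / \<theta>"
    using pos by (simp add: field_simps)
  ultimately obtain m b where m: "m \<le> -1" and b: "greedy_digits a m (-1) b"
    and u: "u = (\<Sum>i=m..-1. of_int (b i) * \<theta> powi i)"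
    using greedy_digits_exist[of u v n] gt_1 by fastforce
  define m' M' c where "m' = m + int k" and "M' = -1 + int k" and "c = (\<lambda>i. b (i - int k))"
  have c: "greedy_digits a m' M' c"
    and x: "x = (\<Sum>i=m'..M'. of_int (c i) * \<theta> powi i)"
    using greedy_digits_shift[OF b, of "int k"] u pos
    by (simp_all add: m'_def M'_def c_def u_def[symmetric])
       (simp add: u_def power_int_minus field_simps)
  \<comment> \<open>The digits found may end in zeros; the exponent must be the lowest position with
    a nonzero digit.\<close>
  define S where "S = {i \<in> {m'..M'}. c i \<noteq> 0}"
  have "S \<noteq> {}"
  proof
    assume "S = {}"
    then have "\<forall>i\<in>{m'..M'}. c i = 0" by (auto simp: S_def)
    then have "x = 0" unfolding x by (intro sum.neutral) auto
    with assms(2) show False by simp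
  qed
  moreover have "finite S" by (rule finite_subset[of _ "{m'..M'}"]) (auto simp: S_def)
  ultimately have "Min S \<in> S" and le: "\<And>i. i \<in> S \<Longrightarrow> Min S \<le> i" by auto
  then have "Min S \<le> M'" "m' \<le> Min S" "c (Min S) \<noteq> 0" by (auto simp: S_def)
  moreover have c0: "c i = 0" if "i \<notin> {Min S..M'}" for i
  proof (cases "i \<in> {m'..M'}")
    case True
    then show ?thesis using that le[of i] by (auto simp: S_def)
  next
    case False
    then show ?thesis using c unfolding greedy_digits_def by blast
  qed
  moreover from this have "greedy_digits a (Min S) M' c"
    using c unfolding greedy_digits_def by blast
  moreover have "x = (\<Sum>i=Min S..M'. of_int (c i) * \<theta> powi i)"
    unfolding x using c0 \<open>m' \<le> Min S\<close> by (intro sum.mono_neutral_right) auto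
  ultimately show ?thesis
    unfolding has_greedy_expansion_def Let_def by blast
qed

lemma greedy_expansion_exists:
  assumes "conj_pair \<theta> x y" "x \<noteq> 0"
  shows "\<exists>m. has_greedy_expansion \<theta> a x m"
proof (cases "x > 0")
  case False
  then show ?thesis
    using greedy_expansion_exists_pos[OF conj_pair_uminus[OF assms(1)]] assms(2)
    by (simp add: has_greedy_expansion_uminus)
qed (use greedy_expansion_exists_pos assms in blast)

text \<open>
  The size bounds on the conjugates leave a single critical case, in which \<open>k = m - 3\<close>, \<open>n = m\<close> and the
  conjugates of \<open>x\<close> and \<open>y\<close> have opposite signs; there the signs determine the parity of \<open>k\<close>.
\<close>

lemma greedy_expansion_diff_le:
  assumes x: "has_greedy_expansion \<theta> a x m" and y: "has_greedy_expansion \<theta> a y n"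
    and z: "has_greedy_expansion \<theta> a (x - y) k" and "m \<le> n"
  shows "m \<le> k + 2"
proof (rule ccontr)
  assume "\<not> m \<le> k + 2"
  obtain r where r: "1 / \<theta> < r" "r < \<theta>" "x \<noteq> 0"
    "conj_pair \<theta> x (sgn x * (-1) powi m * r * \<theta> powi (- m))"
    using greedy_expansion_conj[OF x] by blast
  obtain s where s: "1 / \<theta> < s" "s < \<theta>" "y \<noteq> 0"
    "conj_pair \<theta> y (sgn y * (-1) powi n * s * \<theta> powi (- n))"
    using greedy_expansion_conj[OF y] by blast
  obtain t where t: "1 / \<theta> < t" "t < \<theta>" "x - y \<noteq> 0"
    "conj_pair \<theta> (x - y) (sgn (x - y) * (-1) powi k * t * \<theta> powi (- k))"
    using greedy_expansion_conj[OF z] by blast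
  \<comment> \<open>The absolute values of the three conjugates, so that size and sign can be
    treated separately.\<close>
  define X Y Z where "X = r * \<theta> powi (- m)" and "Y = s * \<theta> powi (- n)" and "Z = t * \<theta> powi (- k)"
  have "1 / \<theta> > 0" using pos by simp
  then have "r > 0" "s > 0" "t > 0" using r s t by linarith+
  then have XYZ: "X > 0" "Y > 0" "Z > 0"
    using powi_pos by (auto simp: X_def Y_def Z_def)
  have sgns: "sgn x \<in> {1, -1}" "sgn y \<in> {1, -1}" "sgn (x - y) \<in> {1, -1}"
    using r(3) s(3) t(3) by (auto simp: sgn_if)
  have powi: "(-1::real) powi i \<in> {1, -1}" for i
    by (cases "even i") auto
  have eq: "sgn x * (-1) powi m * X - sgn y * (-1) powi n * Y = sgn (x - y) * (-1) powi k * Z"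
    using conj_pair_unique[OF conj_pair_diff[OF r(4) s(4)] t(4)]
    by (simp add: X_def Y_def Z_def mult.assoc)
  have X: "X < \<theta> powi (1 - m)"
    using mult_strict_right_mono[OF r(2) powi_pos[of "- m"]] pos
    by (simp add: X_def power_int_diff power_int_minus_divide)
  have Y: "Y < \<theta> powi (1 - n)"
    using mult_strict_right_mono[OF s(2) powi_pos[of "- n"]] pos
    by (simp add: Y_def power_int_diff power_int_minus_divide)
  have Z: "\<theta> powi (- k - 1) < Z"
    using mult_strict_right_mono[OF t(1) powi_pos[of "- k"]] pos
    by (simp add: Z_def power_int_diff)
  have split: "\<theta> powi (2 - m) \<ge> \<theta> powi (1 - m) + \<theta> powi (- m)"
  proof -
    have "\<theta> powi (2 - m) = \<theta>\<^sup>2 * \<theta> powi (- m)"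
      using pos by (simp add: power_int_diff power_int_minus_divide)
    also have "\<dots> = of_int a * \<theta> powi (1 - m) + \<theta> powi (- m)"
      using pos unfolding sq by (simp add: power_int_diff power_int_minus_divide algebra_simps)
    also have "\<dots> \<ge> 1 * \<theta> powi (1 - m) + \<theta> powi (- m)"
      using a_ge_1 powi_pos[of "1 - m"] by (intro add_right_mono mult_right_mono) auto
    finally show ?thesis by simp
  qed
  have "X + Y \<ge> Z"
    using eq sgns powi[of m] powi[of n] powi[of k] XYZ by auto
  have "\<theta> powi (1 - n) \<le> \<theta> powi (1 - m)" using \<open>m \<le> n\<close> by (intro powi_mono) simp
  \<comment> \<open>Excluded by size alone: \<open>X + Y\<close> is below
    \<open>2 * \<theta> powi (1 - m)\<close>, while \<open>Z\<close> exceeds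
    \<open>\<theta>\<^sup>2\<close> times that power, and
    \<open>\<theta>\<^sup>2 \<ge> \<theta> + 1 > 2\<close>.\<close>
  have "\<not> k + 4 \<le> m"
  proof
    assume "k + 4 \<le> m"
    then have "\<theta> powi (3 - m) \<le> \<theta> powi (- k - 1)" by (intro powi_mono) simp
    moreover have "\<theta> powi (3 - m) = \<theta>\<^sup>2 * \<theta> powi (1 - m)"
      using pos by (simp add: power_int_diff power2_eq_square power3_eq_cube)
    moreover have "1 * \<theta> \<le> of_int a * \<theta>"
      using a_ge_1 pos by (intro mult_right_mono) auto
    then have "\<theta>\<^sup>2 > 2"
      using sq gt_1 by linarith
    then have "\<theta>\<^sup>2 * \<theta> powi (1 - m) > 2 * \<theta> powi (1 - m)"
      using powi_pos[of "1 - m"] by (intro mult_strict_right_mono)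
    ultimately show False
      using X Y Z \<open>X + Y \<ge> Z\<close> \<open>\<theta> powi (1 - n) \<le> \<theta> powi (1 - m)\<close> by linarith
  qed
  then have k: "k = m - 3" using \<open>\<not> m \<le> k + 2\<close> by simp
  then have Z': "\<theta> powi (2 - m) < Z" using Z by simp
  have "n = m"
  proof (rule ccontr)
    assume "n \<noteq> m"
    then have "\<theta> powi (1 - n) \<le> \<theta> powi (- m)" using \<open>m \<le> n\<close> by (intro powi_mono) simp
    then show False using X Y Z' \<open>X + Y \<ge> Z\<close> split by linarith
  qed
  have neg: "(-1::real) powi k = - ((-1) powi m)"
    by (cases "even m") (auto simp: k)
  have "X < Z" "Y < Z"
    using X Y Z' split powi_pos[of "- m"] \<open>n = m\<close> by auto
  have "sgn x * X - sgn y * Y = - (sgn (x - y) * Z)"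
    using eq powi[of m] unfolding \<open>n = m\<close> neg by auto
  \<comment> \<open>Equal signs would make \<open>Z\<close> the distance of \<open>X\<close> and
    \<open>Y\<close>, although both are positive and below \<open>Z\<close>. With opposite signs,
    \<open>x - y\<close> has the sign of \<open>x\<close>, whereas the equation demands the other
    one.\<close>
  moreover from this have "sgn x \<noteq> sgn y"
    using sgns XYZ \<open>X < Z\<close> \<open>Y < Z\<close> by auto
  ultimately show False
    using sgns XYZ by (auto simp: sgn_if split: if_splits)
qed

subsection \<open>The pointwise inequality\<close>

lemma theta_abs_0 [simp]: "theta_abs \<theta> a 0 = 0"
  by (simp add: theta_abs_def)

lemma theta_abs_greedy:
  assumes "has_greedy_expansion \<theta> a x m"
  shows "theta_abs \<theta> a x = ereal (\<theta> powi (- m))"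
proof -
  have "(THE m. has_greedy_expansion \<theta> a x m) = m"
    using assms greedy_expansion_unique by blast
  moreover have "x \<noteq> 0" using greedy_expansion_conj[OF assms] by blast
  ultimately show ?thesis
    using assms by (auto simp: theta_abs_def)
qed

lemma theta_abs_cases:
  obtains "x = 0" "theta_abs \<theta> a x = 0"
  | m where "has_greedy_expansion \<theta> a x m" "theta_abs \<theta> a x = ereal (\<theta> powi (- m))"
  | "theta_abs \<theta> a x = \<infinity>"
  using theta_abs_greedy by (metis theta_abs_def)

lemma theta_abs_nonneg: "theta_abs \<theta> a x \<ge> 0"
  by (rule theta_abs_cases[of x]) (use powi_pos in \<open>auto simp: less_imp_le\<close>)

lemma theta_abs_uminus [simp]: "theta_abs \<theta> a (- x) = theta_abs \<theta> a x"
  by (auto simp: theta_abs_def has_greedy_expansion_uminus)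

lemma theta_abs_diff_commute: "theta_abs \<theta> a (x - y) = theta_abs \<theta> a (y - x)"
  using theta_abs_uminus[of "x - y"] by simp

lemma le_theta_sq_mult:
  fixes v :: ereal
  assumes "v \<ge> 0"
  shows "v \<le> ereal (\<theta>\<^sup>2) * v"
proof -
  have "\<theta>\<^sup>2 \<ge> 1" using gt_1 by (simp add: one_le_power)
  then have "1 * v \<le> ereal (\<theta>\<^sup>2) * v"
    using assms by (intro ereal_mult_right_mono) (simp_all add: one_ereal_def)
  then show ?thesis by simp
qed

text \<open>The difference has a conjugate, hence a greedy expansion if it is nonzero; this keeps
  its absolute value finite and reduces the claim to exponents.\<close>

lemma theta_abs_diff_le_greedy:
  assumes x: "has_greedy_expansion \<theta> a x m" and y: "has_greedy_expansion \<theta> a y n" and "m \<le> n"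
  shows "theta_abs \<theta> a (x - y) \<le> ereal (\<theta>\<^sup>2) * theta_abs \<theta> a x"
proof (cases "x = y")
  case True
  then show ?thesis using theta_abs_nonneg[of x] by simp
next
  case False
  have "\<exists>z. conj_pair \<theta> (x - y) z"
    using greedy_expansion_conj[OF x] greedy_expansion_conj[OF y] conj_pair_diff by blast
  then obtain k where k: "has_greedy_expansion \<theta> a (x - y) k"
    using greedy_expansion_exists False by (metis right_minus_eq)
  have "\<theta> powi (- k) \<le> \<theta> powi (2 + - m)"
    using greedy_expansion_diff_le[OF x y k \<open>m \<le> n\<close>] by (intro powi_mono) simp
  also have "\<theta> powi (2 + - m) = \<theta>\<^sup>2 * \<theta> powi (- m)"
    using pos by (subst power_int_add) auto
  finally show ?thesis
    by (simp add: theta_abs_greedy[OF k] theta_abs_greedy[OF x])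
qed

text \<open>For arbitrary reals: a number without a greedy expansion is either 0 or makes the
  right-hand side infinite.\<close>

lemma theta_abs_diff_le:
  "theta_abs \<theta> a (x - y) \<le> ereal (\<theta>\<^sup>2) * max (theta_abs \<theta> a x) (theta_abs \<theta> a y)"
proof -
  consider "x = 0" | "y = 0" | "theta_abs \<theta> a x = \<infinity> \<or> theta_abs \<theta> a y = \<infinity>"
    | m n where "has_greedy_expansion \<theta> a x m" "has_greedy_expansion \<theta> a y n"
    by (metis theta_abs_cases)
  then show ?thesis
  proof cases
    case 1
    then show ?thesis
      using le_theta_sq_mult[OF theta_abs_nonneg[of y]] theta_abs_nonneg[of y] by (simp add: max_absorb2)
  next
    case 2
    then show ?thesis
      using le_theta_sq_mult[OF theta_abs_nonneg[of x]] theta_abs_nonneg[of x] by (simp add: max_absorb1)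
  next
    case 3
    then have "max (theta_abs \<theta> a x) (theta_abs \<theta> a y) = \<infinity>" by (auto simp: max_def)
    then show ?thesis using pos by simp
  next
    case 4
    have *: "theta_abs \<theta> a z \<le> max (theta_abs \<theta> a x) (theta_abs \<theta> a y) \<Longrightarrow>
        ereal (\<theta>\<^sup>2) * theta_abs \<theta> a z \<le> ereal (\<theta>\<^sup>2) * max (theta_abs \<theta> a x) (theta_abs \<theta> a y)" for z
      by (intro ereal_mult_left_mono) auto
    show ?thesis
    proof (cases "m \<le> n")
      case True
      then show ?thesis
        using theta_abs_diff_le_greedy[OF 4] *[of x] by (meson max.cobounded1 order_trans)
    next
      case False
      then show ?thesis
        using theta_abs_diff_le_greedy[OF 4(2,1)] *[of y]
        by (metis max.cobounded2 nle_le order_trans theta_abs_diff_commute)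
    qed
  qed
qed

lemma theta_abs_add_le:
  "theta_abs \<theta> a (x + y) \<le> ereal (\<theta>\<^sup>2) * max (theta_abs \<theta> a x) (theta_abs \<theta> a y)"
  using theta_abs_diff_le[of x "- y"] by simp

subsection \<open>The completion\<close>

lemma powi_floor:
  assumes "r > 0"
  obtains k :: int where "\<theta> powi k \<le> r" "r < \<theta> powi (k + 1)"
proof
  let ?k = "\<lfloor>log \<theta> r\<rfloor>"
  have "\<theta> powr of_int ?k \<le> r" "r < \<theta> powr of_int (?k + 1)"
    using gt_1 assms by (simp_all add: le_log_iff[symmetric] log_less_iff[symmetric])
  then show "\<theta> powi ?k \<le> r" "r < \<theta> powi (?k + 1)"
    unfolding powr_real_of_int'[OF less_imp_le[OF pos]]
    using pos by (simp_all add: powr_real_of_int'[symmetric] del: powr_real_of_int')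
qed

section \<open>Discreteness of the limits superior\<close>

definition abs_values :: "ereal set" where
  "abs_values = {0, \<infinity>} \<union> range (\<lambda>k. ereal (\<theta> powi k))"

definition limit_abs :: "(nat \<Rightarrow> real) \<Rightarrow> ereal" where
  "limit_abs h = limsup (\<lambda>i. theta_abs \<theta> a (h i))"

lemma limit_abs_nonneg: "limit_abs h \<ge> 0"
  unfolding limit_abs_def by (intro le_Limsup always_eventually allI theta_abs_nonneg) simp

text \<open>If the limit superior lies in \<open>[\<theta> powi k, \<theta> powi (k + 1))\<close>,
  the terms are eventually below the right end. Being 0 or powers of \<theta>, they are then at most
  \<open>\<theta> powi k\<close>, which is thus the limit superior.\<close>

lemma limit_abs_in_abs_values: "limit_abs h \<in> abs_values"
proof (cases "limit_abs h")
  case (real r)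
  show ?thesis
  proof (cases "r = 0")
    case False
    then have "r > 0" using real limit_abs_nonneg[of h] by simp
    then obtain k where k: "\<theta> powi k \<le> r" "r < \<theta> powi (k + 1)"
      by (rule powi_floor)
    have "\<forall>\<^sub>F i in sequentially. theta_abs \<theta> a (h i) < ereal (\<theta> powi (k + 1))"
      using k(2) real by (intro Limsup_lessD) (simp add: limit_abs_def[symmetric])
    then have "\<forall>\<^sub>F i in sequentially. theta_abs \<theta> a (h i) \<le> ereal (\<theta> powi k)"
    proof eventually_elim
      case (elim i)
      then show ?case
        using powi_pos[of k]
        by (cases rule: theta_abs_cases[of "h i"]) (auto simp: powi_less_iff less_imp_le intro: powi_mono)
    qed
    then have "limit_abs h \<le> ereal (\<theta> powi k)"
      unfolding limit_abs_def by (rule Limsup_bounded)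
    then show ?thesis
      using k(1) real by (auto simp: abs_values_def)
  qed (simp add: abs_values_def real zero_ereal_def)
qed (use limit_abs_nonneg[of h] in \<open>auto simp: abs_values_def\<close>)

text \<open>Only finitely many powers of \<theta> lie between a given one in \<open>W\<close> and a
  finite bound. An infinite bound is allowed only as a member of \<open>W\<close>, and then it is
  the maximum itself.\<close>

lemma abs_values_Greatest:
  assumes "W \<subseteq> abs_values" "W \<noteq> {}" "\<And>w. w \<in> W \<Longrightarrow> w \<le> B" "B \<in> W \<or> B \<noteq> \<infinity>"
  shows "\<exists>w\<in>W. \<forall>v\<in>W. v \<le> w"
proof -
  consider "B \<in> W" | "W \<subseteq> {0}" | k0 where "ereal (\<theta> powi k0) \<in> W" "B \<noteq> \<infinity>"
    using assms unfolding abs_values_def by fastforce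
  then show ?thesis
  proof cases
    case 3
    have "0 < ereal (\<theta> powi k0)" using powi_pos by simp
    with 3 assms(3) have "0 < B" by (meson less_le_trans)
    then obtain b where b: "B = ereal b" "b > 0" using 3(2) by (cases B) auto
    obtain N where N: "b < \<theta> powi (N + 1)" using powi_floor[OF b(2)] by blast
    define J where "J = {k. ereal (\<theta> powi k) \<in> W \<and> k0 \<le> k}"
    have "k \<le> N" if "k \<in> J" for k
    proof -
      have "\<theta> powi k \<le> b" using that assms(3)[of "ereal (\<theta> powi k)"] b by (simp add: J_def)
      then have "\<theta> powi k < \<theta> powi (N + 1)" using N by simp
      then show ?thesis by (simp add: powi_less_iff)
    qed
    then have "J \<subseteq> {k0..N}" by (auto simp: J_def)
    then have "finite J" by (rule finite_subset) simp
    have "k0 \<in> J" using 3 by (simp add: J_def)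
    with \<open>finite J\<close> have "Max J \<in> J" by (intro Max_in) auto
    have "v \<le> ereal (\<theta> powi (Max J))" if v: "v \<in> W" for v
    proof -
      have "v \<noteq> \<infinity>" using assms(3)[OF v] b by auto
      then consider "v = 0" | k where "v = ereal (\<theta> powi k)"
        using v assms(1) by (auto simp: abs_values_def)
      then show ?thesis
      proof cases
        case 2
        have "k \<le> Max J"
        proof (cases "k0 \<le> k")
          case True
          then show ?thesis using 2 v \<open>finite J\<close> by (intro Max_ge) (auto simp: J_def)
        next
          case False
          then show ?thesis using Max_ge[OF \<open>finite J\<close> \<open>k0 \<in> J\<close>] by simp
        qed
        then show ?thesis using 2 by (auto intro: powi_mono)
      qed (use powi_pos in \<open>simp add: less_imp_le\<close>)
    qed
    then show ?thesis using \<open>Max J \<in> J\<close> by (auto simp: J_def)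
  qed (use assms in blast)+
qed

lemma limsup_max_le:
  fixes u v :: "nat \<Rightarrow> ereal"
  shows "limsup (\<lambda>i. max (u i) (v i)) \<le> max (limsup u) (limsup v)"
  unfolding Limsup_le_iff
proof (intro allI impI)
  fix y assume "max (limsup u) (limsup v) < y"
  then have "\<forall>\<^sub>F i in sequentially. u i < y" "\<forall>\<^sub>F i in sequentially. v i < y"
    by (auto intro: Limsup_lessD)
  then show "\<forall>\<^sub>F i in sequentially. max (u i) (v i) < y"
    by eventually_elim simp
qed

lemma limit_abs_diff_le:
  "limit_abs (\<lambda>i. f i - g i) \<le> ereal (\<theta>\<^sup>2) * max (limit_abs f) (limit_abs g)"
proof -
  have "limit_abs (\<lambda>i. f i - g i)
      \<le> limsup (\<lambda>i. ereal (\<theta>\<^sup>2) * max (theta_abs \<theta> a (f i)) (theta_abs \<theta> a (g i)))"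
    unfolding limit_abs_def by (intro Limsup_mono always_eventually allI theta_abs_diff_le)
  also have "\<dots> = ereal (\<theta>\<^sup>2) * limsup (\<lambda>i. max (theta_abs \<theta> a (f i)) (theta_abs \<theta> a (g i)))"
    by (intro limsup_ereal_mult_left) simp
  also have "\<dots> \<le> ereal (\<theta>\<^sup>2) * max (limit_abs f) (limit_abs g)"
    unfolding limit_abs_def by (intro ereal_mult_left_mono limsup_max_le) simp
  finally show ?thesis .
qed

lemma limit_abs_uminus: "limit_abs (\<lambda>i. - f i) = limit_abs f"
  by (simp add: limit_abs_def)

lemma limit_abs_add_le:
  "limit_abs (\<lambda>i. f i + g i) \<le> ereal (\<theta>\<^sup>2) * max (limit_abs f) (limit_abs g)"
  using limit_abs_diff_le[of f "\<lambda>i. - g i"] by (simp add: limit_abs_uminus)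

lemma tendsto_0_iff_limit_abs:
  "(\<lambda>i. theta_abs \<theta> a (f i)) \<longlonglongrightarrow> 0 \<longleftrightarrow> limit_abs f = 0"
proof
  assume "limit_abs f = 0"
  moreover have "0 \<le> liminf (\<lambda>i. theta_abs \<theta> a (f i))"
    by (intro Liminf_bounded always_eventually allI theta_abs_nonneg)
  ultimately show "(\<lambda>i. theta_abs \<theta> a (f i)) \<longlonglongrightarrow> 0"
    unfolding limit_abs_def
    using Liminf_le_Limsup[of sequentially "\<lambda>i. theta_abs \<theta> a (f i)"]
    by (intro Liminf_eq_Limsup) auto
qed (simp add: limit_abs_def lim_imp_Limsup)

section \<open>The additive group of Cauchy sequences and its quotient\<close>

abbreviation R :: "(nat \<Rightarrow> real) ring" where "R \<equiv> Cauchy_ring \<theta> a"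

abbreviation I :: "(nat \<Rightarrow> real) set" where "I \<equiv> null_ideal \<theta> a"

lemma carrier_iff: "f \<in> carrier R \<longleftrightarrow> (\<forall>n. f n \<in> ring_of_integers \<theta>) \<and> theta_Cauchy \<theta> a f"
  and zero_eq: "\<zero>\<^bsub>R\<^esub> = (\<lambda>_. 0)"
  and add_eq: "f \<oplus>\<^bsub>R\<^esub> g = (\<lambda>n. f n + g n)"
  by (simp_all add: Cauchy_ring_def)

lemma null_ideal_iff: "f \<in> I \<longleftrightarrow> f \<in> carrier R \<and> limit_abs f = 0"
  by (auto simp: null_ideal_def tendsto_0_iff_limit_abs)

lemma theta_Cauchy_add:
  assumes "theta_Cauchy \<theta> a f" "theta_Cauchy \<theta> a g"
  shows "theta_Cauchy \<theta> a (\<lambda>n. f n + g n)"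
  unfolding theta_Cauchy_def
proof (intro allI impI)
  fix \<epsilon> :: real assume "\<epsilon> > 0"
  \<comment> \<open>The division makes up for the factor in \<open>theta_abs_add_le\<close>.\<close>
  then have eps: "\<epsilon> / \<theta>\<^sup>2 > 0" using pos by simp
  obtain N where N: "\<And>i j. i \<ge> N \<Longrightarrow> j \<ge> N \<Longrightarrow> theta_abs \<theta> a (f i - f j) < ereal (\<epsilon> / \<theta>\<^sup>2)"
    using assms(1) eps unfolding theta_Cauchy_def by blast
  obtain N' where N': "\<And>i j. i \<ge> N' \<Longrightarrow> j \<ge> N' \<Longrightarrow> theta_abs \<theta> a (g i - g j) < ereal (\<epsilon> / \<theta>\<^sup>2)"
    using assms(2) eps unfolding theta_Cauchy_def by blast
  have "theta_abs \<theta> a (f i + g i - (f j + g j)) < ereal \<epsilon>" if ij: "i \<ge> max N N'" "j \<ge> max N N'" for i j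
  proof -
    let ?m = "max (theta_abs \<theta> a (f i - f j)) (theta_abs \<theta> a (g i - g j))"
    have "?m < ereal (\<epsilon> / \<theta>\<^sup>2)"
      using N[of i j] N'[of i j] ij by simp
    then have "ereal (\<theta>\<^sup>2) * ?m < ereal (\<theta>\<^sup>2) * ereal (\<epsilon> / \<theta>\<^sup>2)"
      using pos by (intro ereal_mult_strict_left_mono) auto
    moreover have "ereal (\<theta>\<^sup>2) * ereal (\<epsilon> / \<theta>\<^sup>2) = ereal \<epsilon>"
      using pos by simp
    moreover have "theta_abs \<theta> a (f i + g i - (f j + g j)) \<le> ereal (\<theta>\<^sup>2) * ?m"
      using theta_abs_add_le[of "f i - f j" "g i - g j"] by (simp add: algebra_simps)
    ultimately show ?thesis by simp
  qed
  then show "\<exists>N. \<forall>i\<ge>N. \<forall>j\<ge>N. theta_abs \<theta> a (f i + g i - (f j + g j)) < ereal \<epsilon>"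
    by blast
qed

lemma theta_Cauchy_uminus: "theta_Cauchy \<theta> a f \<Longrightarrow> theta_Cauchy \<theta> a (\<lambda>n. - f n)"
proof -
  have "theta_abs \<theta> a (- x - - y) = theta_abs \<theta> a (x - y)" for x y
    using theta_abs_uminus[of "x - y"] by (simp del: theta_abs_uminus)
  then show "theta_Cauchy \<theta> a f \<Longrightarrow> ?thesis" by (simp add: theta_Cauchy_def)
qed

lemma carrier_add: "f \<in> carrier R \<Longrightarrow> g \<in> carrier R \<Longrightarrow> (\<lambda>n. f n + g n) \<in> carrier R"
  by (simp add: carrier_iff ring_of_integers_add theta_Cauchy_add)

lemma carrier_uminus: "f \<in> carrier R \<Longrightarrow> (\<lambda>n. - f n) \<in> carrier R"
  by (simp add: carrier_iff ring_of_integers_uminus theta_Cauchy_uminus)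

lemma carrier_zero: "(\<lambda>n. 0) \<in> carrier R"
  by (auto simp: carrier_iff zero_in_ring_of_integers theta_Cauchy_def)

lemma abelian_group_R: "abelian_group R"
  by (rule abelian_groupI)
     (auto simp: add_eq zero_eq carrier_add carrier_zero add.assoc add.commute
       intro!: bexI[OF _ carrier_uminus])

lemma a_inv_eq:
  assumes "f \<in> carrier R"
  shows "\<ominus>\<^bsub>R\<^esub> f = (\<lambda>n. - f n)"
  by (rule abelian_group.minus_equality[OF abelian_group_R _ assms carrier_uminus[OF assms]])
     (simp add: add_eq zero_eq)

lemma null_ideal_zero: "(\<lambda>n. 0) \<in> I"
  by (simp add: null_ideal_iff carrier_zero limit_abs_def Limsup_const)

lemma abelian_subgroup_I: "abelian_subgroup I R"
proof (rule abelian_subgroupI3[OF _ abelian_group_R])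
  interpret abelian_group R by (rule abelian_group_R)
  have add: "(\<lambda>n. f n + g n) \<in> I" if "f \<in> I" "g \<in> I" for f g
  proof -
    have "limit_abs (\<lambda>n. f n + g n) = 0"
      using that limit_abs_add_le[of f g] limit_abs_nonneg[of "\<lambda>n. f n + g n"]
      by (simp add: null_ideal_iff)
    then show ?thesis using that by (simp add: null_ideal_iff carrier_add)
  qed
  have "subgroup I (add_monoid R)"
  proof (rule add.group_axioms[THEN group.subgroupI])
    show "I \<subseteq> carrier (add_monoid R)" by (auto simp: null_ideal_iff)
    show "I \<noteq> {}" using null_ideal_zero by blast
    show "inv\<^bsub>add_monoid R\<^esub> f \<in> I" if "f \<in> I" for f
      using that a_inv_eq[of f] carrier_uminus[of f]
      by (simp add: null_ideal_iff a_inv_def limit_abs_uminus)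
    show "f \<otimes>\<^bsub>add_monoid R\<^esub> g \<in> I" if "f \<in> I" "g \<in> I" for f g
      using add[OF that] by (simp add: add_eq)
  qed
  then show "additive_subgroup I R" by (rule additive_subgroup.intro)
qed

lemma completion_carrier_iff:
  "F \<in> carrier (theta_completion \<theta> a) \<longleftrightarrow> (\<exists>f\<in>carrier R. F = {\<lambda>i. n i + f i | n. n \<in> I})"
proof -
  have "carrier (theta_completion \<theta> a) = a_rcosets\<^bsub>R\<^esub> I"
    by (simp add: theta_completion_def FactRing_def)
  moreover have "I +>\<^bsub>R\<^esub> f = {\<lambda>i. n i + f i | n. n \<in> I}" for f
    by (auto simp: a_r_coset_def' add_eq)
  ultimately show ?thesis by (auto simp: A_RCOSETS_def')
qed

text \<open>
  Only the additive structure is used: unless \<open>\<int>[\<theta>]\<close> is the full ring of integers, the null sequences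
  are not an ideal, because the product of \<open>\<theta> ^ n\<close> with an integer outside \<open>\<int>[\<theta>]\<close> has infinite
  absolute value.
\<close>

lemma completion_diff:
  assumes F: "F \<in> carrier (theta_completion \<theta> a)" and G: "G \<in> carrier (theta_completion \<theta> a)"
  shows "F \<ominus>\<^bsub>theta_completion \<theta> a\<^esub> G \<in> carrier (theta_completion \<theta> a)"
    and "F \<ominus>\<^bsub>theta_completion \<theta> a\<^esub> G = {\<lambda>i. f i - g i | f g. f \<in> F \<and> g \<in> G}"
proof -
  interpret abelian_subgroup I R by (rule abelian_subgroup_I)
  interpret Q: comm_group "R A_Mod I" by (rule a_factorgroup_is_comm_group)
  let ?Q = "theta_completion \<theta> a"
  \<comment> \<open>The additive group of the quotient ring is the factor group by \<open>I\<close>,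
    so closure and inverses come from group theory.\<close>
  have add_monoid: "add_monoid ?Q = R A_Mod I"
    by (simp add: theta_completion_def FactRing_def A_FactGroup_def')
  have carrier: "carrier (R A_Mod I) = carrier ?Q"
    by (simp add: theta_completion_def FactRing_def A_FactGroup_def')
  have diff: "F \<ominus>\<^bsub>?Q\<^esub> G = F \<otimes>\<^bsub>R A_Mod I\<^esub> inv\<^bsub>R A_Mod I\<^esub> G"
    unfolding a_minus_def a_inv_def add_monoid
    by (simp add: theta_completion_def FactRing_def A_FactGroup_def')
  show "F \<ominus>\<^bsub>?Q\<^esub> G \<in> carrier ?Q"
    unfolding diff using Q.m_closed Q.inv_closed F G unfolding carrier by blast
  have "G \<subseteq> carrier R"
    using G unfolding completion_carrier_iff by (auto simp: null_ideal_iff intro: carrier_add)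
  then have "a_set_inv\<^bsub>R\<^esub> G = {\<lambda>i. - g i | g. g \<in> G}"
    unfolding A_SET_INV_def' by (force simp: a_inv_eq subset_iff)
  then show "F \<ominus>\<^bsub>?Q\<^esub> G = {\<lambda>i. f i - g i | f g. f \<in> F \<and> g \<in> G}"
    using G unfolding diff
    by (simp add: a_inv_FactGroup carrier set_add_def' add_eq) (force simp: fun_eq_iff)
qed

text \<open>Representatives differ by null sequences, so the weak triangle inequality bounds
  \<open>limit_abs\<close> on the whole coset by \<open>\<theta>\<^sup>2\<close> times its value at
  one representative. Discreteness then yields a maximum, which gives \<open>GREATEST\<close> its
  meaning.\<close>

lemma completion_abs_attained:
  assumes "F \<in> carrier (theta_completion \<theta> a)"
  shows "\<exists>f\<in>F. completion_abs \<theta> a F = limit_abs f" and "h \<in> F \<Longrightarrow> limit_abs h \<le> completion_abs \<theta> a F"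
proof -
  obtain f where f: "f \<in> carrier R" and F: "F = {\<lambda>i. n i + f i | n. n \<in> I}"
    using assms by (auto simp: completion_carrier_iff)
  have "f \<in> F"
    unfolding F using null_ideal_zero by force
  have bound: "limit_abs h \<le> ereal (\<theta>\<^sup>2) * limit_abs f" if h: "h \<in> F" for h
  proof -
    obtain n where "limit_abs n = 0" "h = (\<lambda>i. n i + f i)"
      using h by (auto simp: F null_ideal_iff)
    then show ?thesis
      using limit_abs_add_le[of n f] limit_abs_nonneg[of f] by (simp add: max_absorb2)
  qed
  have "\<exists>w\<in>limit_abs ` F. \<forall>v\<in>limit_abs ` F. v \<le> w"
  proof (rule abs_values_Greatest)
    show "limit_abs ` F \<subseteq> abs_values" using limit_abs_in_abs_values by blast
    show "limit_abs ` F \<noteq> {}" using \<open>f \<in> F\<close> by blast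
    show "w \<le> ereal (\<theta>\<^sup>2) * limit_abs f" if "w \<in> limit_abs ` F" for w
      using that bound by blast
    \<comment> \<open>If \<open>limit_abs f\<close> is infinite, the bound is infinite too but
      attained by \<open>f\<close>.\<close>
    show "ereal (\<theta>\<^sup>2) * limit_abs f \<in> limit_abs ` F \<or> ereal (\<theta>\<^sup>2) * limit_abs f \<noteq> \<infinity>"
    proof (cases "limit_abs f = \<infinity>")
      case True
      then have "ereal (\<theta>\<^sup>2) * limit_abs f = limit_abs f" using pos by simp
      then show ?thesis using \<open>f \<in> F\<close> by (metis imageI)
    next
      case False
      then show ?thesis using limit_abs_nonneg[of f] by (cases "limit_abs f") auto
    qed
  qed
  then obtain g where g: "g \<in> F" "\<And>h. h \<in> F \<Longrightarrow> limit_abs h \<le> limit_abs g" by blast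
  have "completion_abs \<theta> a F = limit_abs g"
    unfolding completion_abs_def
    by (rule Greatest_equality) (use g in \<open>auto simp: limit_abs_def\<close>)
  with g show "\<exists>f\<in>F. completion_abs \<theta> a F = limit_abs f"
    and "h \<in> F \<Longrightarrow> limit_abs h \<le> completion_abs \<theta> a F" by auto
qed

end

theorem theorem12:
  fixes \<theta> :: real and a :: int and F G :: "(nat \<Rightarrow> real) set"
  assumes "\<theta> > 1" and "quadratic_unit \<theta> a (-1)"
    and "F \<in> carrier (theta_completion \<theta> a)" and "G \<in> carrier (theta_completion \<theta> a)"
  shows "completion_abs \<theta> a (F \<ominus>\<^bsub>theta_completion \<theta> a\<^esub> G)
           \<le> ereal (\<theta>\<^sup>2) * max (completion_abs \<theta> a F) (completion_abs \<theta> a G)"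
proof -
  interpret negative_norm_unit \<theta> a
    using assms by unfold_locales
  \<comment> \<open>\<open>h\<close> attains the maximum for the difference. The \<open>f\<close>
    and \<open>g\<close> that it splits into need not attain theirs; they only have to stay below
    them.\<close>
  obtain h where "h \<in> F \<ominus>\<^bsub>theta_completion \<theta> a\<^esub> G"
    and h: "completion_abs \<theta> a (F \<ominus>\<^bsub>theta_completion \<theta> a\<^esub> G) = limit_abs h"
    using completion_abs_attained(1)[OF completion_diff(1)[OF assms(3,4)]] by blast
  then obtain f g where fg: "f \<in> F" "g \<in> G" "h = (\<lambda>i. f i - g i)"
    unfolding completion_diff(2)[OF assms(3,4)] by blast
  have "limit_abs h \<le> ereal (\<theta>\<^sup>2) * max (limit_abs f) (limit_abs g)"
    unfolding fg(3) by (rule limit_abs_diff_le)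
  also have "\<dots> \<le> ereal (\<theta>\<^sup>2) * max (completion_abs \<theta> a F) (completion_abs \<theta> a G)"
    using completion_abs_attained(2)[OF assms(3) fg(1)] completion_abs_attained(2)[OF assms(4) fg(2)]
    by (intro ereal_mult_left_mono max.mono) auto
  finally show ?thesis unfolding h .
qed
end
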